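(* Let $C_x\subseteq\mathcal{M}$ denote the correct set and $F_x=\mathcal{M}\setminus C_x$ the failure set of a query $x$, and let $Y$ be a random subset of $\mathcal{M}$ distributed according to the determinantal point process (DPP) $\mathcal{P}_{L_x}$. The hit probability decomposes as $$P_{\mathrm{succ}}(x)=1-P(Y\subseteq F_x)=\sum_{\substack{S\subseteq\mathcal{M}\\ S\cap C_x\neq\emptyset}}\mathcal{P}_{L_x}(S).$$ Consequently, minimizing the coverage loss $\mathcal{L}_{\mathrm{hit}}(x)$ is equivalent to maximizing the total DPP probability mass assigned to subsets that contain at least one correct model (that is, at least one element of $C_x$).
   Context: $\mathcal{M}=\{1,\dots,M\}$ is a finite set of models. For a query $x$, each model $i$ carries a label $y_i\in\{0,1\}$, with $y_i=1$ if model $i$ answers $x$ correctly and $y_i=0$ otherwise; $C_x=\{i\in\mathcal{M}: y_i=1\}$ and $F_x=\{i\in\mathcal{M}: y_i=0\}$. The query-dependent kernel $L_x\in\mathbb{R}^{M\times M}$ is a (symmetric) positive semidefinite matrix, and the DPP ($L$-ensemble) $\mathcal{P}_{L_x}$ is the probability distribution on subsets of $\mathcal{M}$ given by $$\mathcal{P}_{L_x}(S)=\frac{\det((L_x)_S)}{\det(I+L_x)},\qquad S\subseteq\mathcal{M},$$ where $(L_x)_S$ is the principal submatrix of $L_x$ indexed by $S$ (with the determinant of the empty matrix equal to $1$) and $I$ is the identity matrix of the appropriate size. The hit (success) probability is $P_{\mathrm{succ}}(x)=1-P(Y\subseteq F_x)$, where $$P(Y\subseteq F_x)=\sum_{S\subseteq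 F_x}\mathcal{P}_{L_x}(S)=\frac{\det(I+(L_x)_{F_x})}{\det(I+L_x)}.$$ The coverage loss is $$\mathcal{L}_{\mathrm{hit}}(x)=-\log P_{\mathrm{succ}}(x)=-\log\left(1-\frac{\det(I+(L_x)_{F_x})}{\det(I+L_x)}\right).$$ *)

theory Defs
  imports
    "HOL-Probability.Probability_Measure"
    "Jordan_Normal_Form.Determinant"
    "Jordan_Normal_Form.DL_Submatrix"
begin

text \<open>
  Rows and columns of a matrix are indexed from 0 in the matrix library, so the ground set of
  \<open>M\<close> models is \<open>{..<M}\<close> instead of \<open>{1..M}\<close>.
\<close>

abbreviation models :: "nat \<Rightarrow> nat set" where
  "models M \<equiv> {..<M}"

definition psd_kernel :: "nat \<Rightarrow> real mat \<Rightarrow> bool" where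
  "psd_kernel M L \<longleftrightarrow>
     L \<in> carrier_mat M M \<and> transpose_mat L = L \<and>
     (\<forall>v \<in> carrier_vec M. 0 \<le> scalar_prod v (mult_mat_vec L v))"

abbreviation principal_submatrix :: "'a mat \<Rightarrow> nat set \<Rightarrow> 'a mat" where
  "principal_submatrix L S \<equiv> submatrix L S S"

definition dpp_mass :: "nat \<Rightarrow> real mat \<Rightarrow> nat set \<Rightarrow> real" where
  "dpp_mass M L S =
     Determinant.det (principal_submatrix L S) / Determinant.det (one_mat M + L)"

definition dpp :: "nat \<Rightarrow> real mat \<Rightarrow> nat set measure" where
  "dpp M L = point_measure (Pow (models M)) (\<lambda>S. ennreal (dpp_mass M L S))"

definition dpp_random_subset :: "'w measure \<Rightarrow> ('w \<Rightarrow> nat set) \<Rightarrow> nat \<Rightarrow> real mat \<Rightarrow> bool" where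
  "dpp_random_subset \<Omega> Y M L \<longleftrightarrow>
     prob_space \<Omega> \<and> Y \<in> measurable \<Omega> (count_space (Pow (models M))) \<and>
     distr \<Omega> (count_space (Pow (models M))) Y = dpp M L"

text \<open>
  The probability that a sample is not contained in the failure set, where \<open>C\<close> is the correct set.
\<close>

definition success_prob :: "nat \<Rightarrow> real mat \<Rightarrow> nat set \<Rightarrow> real" where
  "success_prob M L C = 1 - measure (dpp M L) {S \<in> space (dpp M L). S \<subseteq> models M - C}"

text \<open>
  The success probability may vanish (for example if \<open>C\<close> is empty), and then the loss is infinite;
  the real function \<open>ln\<close> would give \<open>ln 0 = 0\<close>.
\<close>

definition neg_log :: "real \<Rightarrow> ereal" where
  "neg_log p = (if p \<le> 0 then \<infinity> else ereal (- ln p))"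

definition coverage_loss :: "nat \<Rightarrow> real mat \<Rightarrow> nat set \<Rightarrow> ereal" where
  "coverage_loss M L C = neg_log (success_prob M L C)"

end

theory Submission
  imports Defs "Jordan_Normal_Form.Char_Poly"
begin

text \<open>
  Expanding the product in the Leibniz formula of \<open>det (1 + A)\<close> over the choice of the
  diagonal unit or the entry of \<open>A\<close> in each row gives the sum of all principal minors of \<open>A\<close>.
  The principal minors of a positive semidefinite matrix are nonnegative, because
  \<open>det (t 1 + A)\<close> is a monic polynomial in \<open>t\<close> without positive roots. So \<open>dpp_mass\<close> is a
  probability mass function, and a subset of the models either lies in the failure set or meets
  the correct set. The minimisers correspond because \<open>neg_log\<close> is strictly decreasing on the
  nonnegative reals.
\<close>

section \<open>Leibniz sums over arbitrary finite index sets\<close>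

lemma bij_betw_map_permutation:
  assumes "bij_betw f A B"
  shows "bij_betw (map_permutation A f) {p. p permutes A} {p. p permutes B}"
\<comment> \<open>\<open>map_permutation\<close> is conjugation by \<open>f\<close>, so conjugation
  by the inverse bijection undoes it.\<close>
proof (rule bij_betw_byWitness[where f' = "map_permutation B (inv_into A f)"])
  have inv: "bij_betw (inv_into A f) B A"
    using assms by (rule bij_betw_inv_into)
  show "\<forall>p\<in>{p. p permutes A}. map_permutation B (inv_into A f) (map_permutation A f p) = p"
    using assms by (auto intro!: map_permutation_compose_inv bij_betw_inv_into_left)
  show "\<forall>p\<in>{p. p permutes B}. map_permutation A f (map_permutation B (inv_into A f) p) = p"
    using assms inv map_permutation_compose_inv[OF inv] by (auto simp: bij_betw_inv_into_right)
  show "map_permutation A f ` {p. p permutes A} \<subseteq> {p. p permutes B}"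
    using assms by (auto intro: map_permutation_permutes)
  show "map_permutation B (inv_into A f) ` {p. p permutes B} \<subseteq> {p. p permutes A}"
    using inv by (auto intro: map_permutation_permutes)
qed

text \<open>Conjugation by \<open>f\<close> carries permutations of positions to permutations of
  \<open>F\<close> and keeps the sign, so the enumeration of \<open>F\<close> does not affect the
  determinant. Minors for different index sets can thus be compared without their
  enumerations.\<close>

lemma det_mat_reindex:
  fixes a :: "'b \<Rightarrow> 'b \<Rightarrow> 'a :: comm_ring_1"
  assumes "bij_betw f {0..<n} F"
  shows "Determinant.det (mat n n (\<lambda>(i, j). a (f i) (f j))) =
    (\<Sum>p | p permutes F. of_int (sign p) * (\<Prod>i\<in>F. a i (p i)))"
proof -
  have inj: "inj_on f {0..<n}"
    using assms by (rule bij_betw_imp_inj_on)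
  have "(\<Sum>p | p permutes F. of_int (sign p) * (\<Prod>i\<in>F. a i (p i))) =
    (\<Sum>p | p permutes {0..<n}. of_int (sign (map_permutation {0..<n} f p)) *
      (\<Prod>i\<in>F. a i (map_permutation {0..<n} f p i)))"
    by (rule sum.reindex_bij_betw[symmetric, OF bij_betw_map_permutation[OF assms]])
  also have "\<dots> = (\<Sum>p | p permutes {0..<n}. of_int (sign p) *
      (\<Prod>i = 0..<n. mat n n (\<lambda>(i, j). a (f i) (f j)) $$ (i, p i)))"
  proof (rule sum.cong[OF refl])
    fix p assume "p \<in> {p. p permutes {0..<n}}"
    then have p: "p permutes {0..<n}" by simp
    have "(\<Prod>i\<in>F. a i (map_permutation {0..<n} f p i)) =
      (\<Prod>i = 0..<n. a (f i) (map_permutation {0..<n} f p (f i)))"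
      by (rule prod.reindex_bij_betw[symmetric, OF assms])
    also have "\<dots> = (\<Prod>i = 0..<n. mat n n (\<lambda>(i, j). a (f i) (f j)) $$ (i, p i))"
    proof (rule prod.cong[OF refl])
      fix i assume i: "i \<in> {0..<n}"
      then have "p i < n" using p by (metis atLeastLessThan_iff permutes_in_image)
      with i show "a (f i) (map_permutation {0..<n} f p (f i)) =
        mat n n (\<lambda>(i, j). a (f i) (f j)) $$ (i, p i)"
        by (simp add: map_permutation_apply[OF inj])
    qed
    finally show "of_int (sign (map_permutation {0..<n} f p)) *
        (\<Prod>i\<in>F. a i (map_permutation {0..<n} f p i)) =
      of_int (sign p) * (\<Prod>i = 0..<n. mat n n (\<lambda>(i, j). a (f i) (f j)) $$ (i, p i))"
      using sign_map_permutation[OF inj p] by simp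
  qed
  also have "\<dots> = Determinant.det (mat n n (\<lambda>(i, j). a (f i) (f j)))"
    by (rule det_def'[symmetric]) simp
  finally show ?thesis by simp
qed

text \<open>Here \<open>S\<close> collects the rows that contribute an entry of \<open>a\<close>.
  The other rows contribute the indicator of \<open>i = p i\<close>, so only permutations fixing all
  of \<open>F - S\<close> survive, and these are the permutations of \<open>S\<close>.\<close>

lemma sum_permutes_prod_add_diagonal:
  fixes a :: "'b \<Rightarrow> 'b \<Rightarrow> 'a :: comm_ring_1"
  assumes "finite F"
  shows "(\<Sum>p | p permutes F. of_int (sign p) * (\<Prod>i\<in>F. a i (p i) + of_bool (i = p i))) =
    (\<Sum>S\<in>Pow F. \<Sum>p | p permutes S. of_int (sign p) * (\<Prod>i\<in>S. a i (p i)))"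
proof -
  let ?t = "\<lambda>p S. of_int (sign p) *
    ((\<Prod>i\<in>S. a i (p i)) * (\<Prod>i\<in>F - S. of_bool (i = p i)))"
  have "(\<Sum>p | p permutes F. of_int (sign p) * (\<Prod>i\<in>F. a i (p i) + of_bool (i = p i))) =
    (\<Sum>p | p permutes F. \<Sum>S\<in>Pow F. ?t p S)"
    by (simp add: prod_add[OF assms] sum_distrib_left)
  also have "\<dots> = (\<Sum>S\<in>Pow F. \<Sum>p | p permutes F. ?t p S)"
    by (rule sum.swap)
  also have "\<dots> = (\<Sum>S\<in>Pow F. \<Sum>p | p permutes S. of_int (sign p) * (\<Prod>i\<in>S. a i (p i)))"
  proof (rule sum.cong[OF refl])
    fix S assume "S \<in> Pow F"
    then have S: "S \<subseteq> F" by simp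
    have "(\<Sum>p | p permutes F. ?t p S) = (\<Sum>p | p permutes S. ?t p S)"
    proof (rule sum.mono_neutral_right)
      show "finite {p. p permutes F}"
        using assms by (rule finite_permutations)
      show "{p. p permutes S} \<subseteq> {p. p permutes F}"
        using S by (auto intro: permutes_subset)
      show "\<forall>p\<in>{p. p permutes F} - {p. p permutes S}. ?t p S = 0"
      proof
        fix p assume "p \<in> {p. p permutes F} - {p. p permutes S}"
        \<comment> \<open>If \<open>p\<close> fixed every point of \<open>F - S\<close>, it would
          already permute \<open>S\<close>.\<close>
        then obtain i where "i \<in> F - S" "p i \<noteq> i"
          by (auto intro: permutes_superset)
        then have "(\<Prod>i\<in>F - S. of_bool (i = p i)) = (0 :: 'a)"
          using assms by (intro prod_zero bexI[of _ i]) auto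
        then show "?t p S = 0" by simp
      qed
    qed
    also have "\<dots> = (\<Sum>p | p permutes S. of_int (sign p) * (\<Prod>i\<in>S. a i (p i)))"
    proof (rule sum.cong[OF refl])
      fix p assume "p \<in> {p. p permutes S}"
      then have "(\<Prod>i\<in>F - S. of_bool (i = p i)) = (1 :: 'a)"
        by (intro prod.neutral) (auto simp: permutes_not_in)
      then show "?t p S = of_int (sign p) * (\<Prod>i\<in>S. a i (p i))" by simp
    qed
    finally show "(\<Sum>p | p permutes F. ?t p S) =
      (\<Sum>p | p permutes S. of_int (sign p) * (\<Prod>i\<in>S. a i (p i)))" .
  qed
  finally show ?thesis .
qed

section \<open>Principal minors and the determinant of 1 + A\<close>

lemma bij_betw_pick:
  assumes "finite S"
  shows "bij_betw (pick S) {0..<card S} S"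
\<comment> \<open>\<open>pick S\<close> enumerates \<open>S\<close> increasingly from 0, so its
  inverse is the rank: the number of smaller elements of \<open>S\<close>.\<close>
proof (rule bij_betw_byWitness[where f' = "\<lambda>i. card {a\<in>S. a < i}"])
  show "\<forall>i\<in>{0..<card S}. card {a\<in>S. a < pick S i} = i"
    by (simp add: card_pick_le)
  show "\<forall>i\<in>S. pick S (card {a\<in>S. a < i}) = i"
    by (simp add: pick_card_in_set)
  show "pick S ` {0..<card S} \<subseteq> S"
    by (auto intro: pick_in_set_le)
  show "(\<lambda>i. card {a\<in>S. a < i}) ` S \<subseteq> {0..<card S}"
    using assms by (auto intro!: psubset_card_mono)
qed

lemma principal_submatrix_eq:
  assumes "A \<in> carrier_mat n n" "S \<subseteq> {..<n}"
  shows "principal_submatrix A S =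
    mat (card S) (card S) (\<lambda>(i, j). A $$ (pick S i, pick S j))"
proof -
  have "{i. i < n \<and> i \<in> S} = S" using assms(2) by auto
  then show ?thesis using assms(1) by (simp add: submatrix_def)
qed

lemma principal_submatrix_lessThan:
  assumes "A \<in> carrier_mat n n"
  shows "principal_submatrix A {..<n} = A"
proof -
  have "pick {..<n} i = i" if "i < n" for i
  proof -
    have "{a \<in> {..<n}. a < i} = {..<i}" using that by auto
    then show ?thesis using pick_card_in_set[of i "{..<n}"] that by simp
  qed
  then show ?thesis
    using assms by (intro eq_matI) (auto simp: principal_submatrix_eq)
qed

lemma det_principal_submatrix:
  assumes "A \<in> carrier_mat n n" "S \<subseteq> {..<n}"
  shows "Determinant.det (principal_submatrix A S) =
    (\<Sum>p | p permutes S. of_int (sign p) * (\<Prod>i\<in>S. A $$ (i, p i)))"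
  using det_mat_reindex[OF bij_betw_pick, of S "\<lambda>i j. A $$ (i, j)"] assms
  by (simp add: principal_submatrix_eq finite_subset)

text \<open>Used for two index sets: the full one gives the normalising constant of the DPP, the
  failure set gives the numerator of the miss probability.\<close>

lemma det_one_plus_principal_submatrix:
  fixes A :: "'a :: comm_ring_1 mat"
  assumes A: "A \<in> carrier_mat n n" and F: "F \<subseteq> {..<n}"
  shows "Determinant.det (one_mat (card F) + principal_submatrix A F) =
    (\<Sum>S\<in>Pow F. Determinant.det (principal_submatrix A S))"
proof -
  have fin: "finite F" using F by (rule finite_subset) simp
  \<comment> \<open>Injectivity of \<open>pick F\<close> turns the unit matrix on positions into the
    equality indicator on elements of \<open>F\<close>, the form needed for reindexing.\<close>
  have pick_eq: "pick F i = pick F j \<longleftrightarrow> i = j" if "i < card F" "j < card F" for i j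
    using bij_betw_imp_inj_on[OF bij_betw_pick[OF fin]] that by (auto simp: inj_on_eq_iff)
  have "one_mat (card F) + principal_submatrix A F =
    mat (card F) (card F)
      (\<lambda>(i, j). A $$ (pick F i, pick F j) + of_bool (pick F i = pick F j))"
    by (rule eq_matI) (auto simp: principal_submatrix_eq[OF A F] pick_eq)
  then have "Determinant.det (one_mat (card F) + principal_submatrix A F) =
    (\<Sum>p | p permutes F. of_int (sign p) * (\<Prod>i\<in>F. A $$ (i, p i) + of_bool (i = p i)))"
    using det_mat_reindex[OF bij_betw_pick[OF fin], of "\<lambda>i j. A $$ (i, j) + of_bool (i = j)"]
    by simp
  also have "\<dots> = (\<Sum>S\<in>Pow F. Determinant.det (principal_submatrix A S))"
    unfolding sum_permutes_prod_add_diagonal[OF fin, of "\<lambda>i j. A $$ (i, j)"]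
    using F by (intro sum.cong refl det_principal_submatrix[OF A, symmetric]) auto
  finally show ?thesis .
qed

lemma det_one_plus:
  assumes "A \<in> carrier_mat n n"
  shows "Determinant.det (one_mat n + A) =
    (\<Sum>S\<in>Pow {..<n}. Determinant.det (principal_submatrix A S))"
  using det_one_plus_principal_submatrix[OF assms order.refl]
  by (simp add: principal_submatrix_lessThan[OF assms])

section \<open>Nonnegativity of the principal minors\<close>

lemma psd_kernel_det_nonneg:
  assumes "psd_kernel n A"
  shows "0 \<le> Determinant.det A"
proof (rule ccontr)
  assume neg: "\<not> 0 \<le> Determinant.det A"
  have A: "A \<in> carrier_mat n n" and quad: "\<And>v. v \<in> carrier_vec n \<Longrightarrow> 0 \<le> v \<bullet> (A *\<^sub>v v)"
    using assms by (auto simp: psd_kernel_def)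
  have mA: "- A \<in> carrier_mat n n" using A by simp
  \<comment> \<open>The sign is chosen so that \<open>q\<close> at t is
    \<open>det (t 1 + A)\<close>; in particular its value at 0 is \<open>det A\<close>.\<close>
  define q where "q = char_poly (- A)"
  have "- char_matrix (- A) 0 = A"
    using A by (intro eq_matI) (auto simp: char_matrix_def)
  then have "poly q 0 < 0"
    using neg char_poly_matrix[OF mA, of 0] by (simp add: q_def)
  moreover have "lead_coeff q > 0"
    using degree_monic_char_poly[OF mA] by (simp add: q_def)
  then obtain b where "\<And>x. b \<le> x \<Longrightarrow> lead_coeff q \<le> poly q x"
    using poly_pinfty_gt_lc by blast
  \<comment> \<open>The maximum with 1 keeps the point to the right of 0, so the intermediate value
    theorem yields a strictly positive root.\<close>
  then have "0 < poly q (max b 1)"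
    using \<open>lead_coeff q > 0\<close> by (meson max.cobounded1 order_less_le_trans)
  ultimately obtain t where t: "0 < t" "poly q t = 0"
    using poly_IVT_pos[of 0 "max b 1" q] by (auto simp: less_max_iff_disj)
  \<comment> \<open>The root is an eigenvalue of \<open>- A\<close>; on its eigenvector the
    quadratic form of \<open>A\<close> equals \<open>- t\<close> times the squared norm, which is
    negative.\<close>
  then obtain v where v: "v \<in> carrier_vec n" "v \<noteq> 0\<^sub>v n" "(- A) *\<^sub>v v = t \<cdot>\<^sub>v v"
    using eigenvalue_root_char_poly[OF mA, of t] A
    by (auto simp: q_def eigenvalue_def eigenvector_def)
  have "- (A *\<^sub>v v) = t \<cdot>\<^sub>v v"
    using v A by (metis uminus_mult_mat_vec carrier_matD(2) carrier_vecD)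
  then have "A *\<^sub>v v = - (t \<cdot>\<^sub>v v)"
    by (metis uminus_uminus_vec)
  then have "v \<bullet> (A *\<^sub>v v) = - (t * (v \<bullet> v))"
    using v by simp
  moreover have "0 < v \<bullet> v"
  proof -
    have "v \<bullet> v = (\<Sum>i<n. (v $ i)\<^sup>2)"
      using v by (simp add: scalar_prod_def power2_eq_square lessThan_atLeast0)
    moreover obtain i where "i < n" "v $ i \<noteq> 0"
      using v by (metis carrier_vecD eq_vecI index_zero_vec)
    then have "0 < (\<Sum>i<n. (v $ i)\<^sup>2)"
      by (intro sum_pos2[of _ i]) auto
    ultimately show ?thesis by simp
  qed
  ultimately show False
    using quad[OF v(1)] t(1) by (simp add: mult_le_0_iff)
qed

text \<open>Extending a vector on \<open>S\<close> by zero preserves the value of the quadratic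
  form, so positivity is inherited.\<close>

lemma psd_kernel_principal_submatrix:
  assumes "psd_kernel n A" and S: "S \<subseteq> {..<n}"
  shows "psd_kernel (card S) (principal_submatrix A S)"
proof -
  have A: "A \<in> carrier_mat n n" and sym: "transpose_mat A = A"
    and quad: "\<And>v. v \<in> carrier_vec n \<Longrightarrow> 0 \<le> v \<bullet> (A *\<^sub>v v)"
    using assms by (auto simp: psd_kernel_def)
  have fin: "finite S" using S by (rule finite_subset) simp
  have pick_in: "pick S i \<in> S" if "i < card S" for i
    using that by (rule pick_in_set_le)
  then have pick_less: "pick S i < n" if "i < card S" for i
    using that S by blast
  have entry: "A $$ (i, j) = A $$ (j, i)" if "i < n" "j < n" for i j
    using that A sym by (metis carrier_matD index_transpose_mat(1))
  have "0 \<le> v \<bullet> (principal_submatrix A S *\<^sub>v v)" if v: "v \<in> carrier_vec (card S)" for v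
  proof -
    \<comment> \<open>The zero extension: an element of \<open>S\<close> receives the coordinate of
      \<open>v\<close> at its rank in \<open>S\<close>.\<close>
    define w where "w = vec n (\<lambda>i. if i \<in> S then v $ card {a\<in>S. a < i} else 0)"
    have w_pick: "w $ pick S i = v $ i" if "i < card S" for i
      using that by (simp add: w_def pick_less pick_in card_pick_le)
    \<comment> \<open>The weight \<open>g\<close> is left arbitrary so that the same identity
      rewrites both nested sums of the quadratic form.\<close>
    have restrict: "(\<Sum>i = 0..<n. w $ i * g i) = (\<Sum>i = 0..<card S. v $ i * g (pick S i))" for g
    proof -
      have "(\<Sum>i = 0..<n. w $ i * g i) = (\<Sum>i\<in>S. w $ i * g i)"
        using S by (intro sum.mono_neutral_right) (auto simp: w_def)
      also have "\<dots> = (\<Sum>i = 0..<card S. w $ pick S i * g (pick S i))"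
        by (rule sum.reindex_bij_betw[symmetric, OF bij_betw_pick[OF fin]])
      finally show ?thesis by (simp add: w_pick)
    qed
    have "w \<bullet> (A *\<^sub>v w) = (\<Sum>i = 0..<n. w $ i * (\<Sum>j = 0..<n. w $ j * A $$ (i, j)))"
      using A by (simp add: scalar_prod_def w_def mult.commute)
    also have "\<dots> = (\<Sum>i = 0..<card S. v $ i *
      (\<Sum>j = 0..<card S. v $ j * A $$ (pick S i, pick S j)))"
      by (simp only: restrict)
    also have "\<dots> = v \<bullet> (principal_submatrix A S *\<^sub>v v)"
      using v by (simp add: principal_submatrix_eq[OF A S] scalar_prod_def mult.commute)
    finally show ?thesis
      using quad[of w] by (simp add: w_def)
  qed
  moreover have "transpose_mat (principal_submatrix A S) = principal_submatrix A S"
    by (rule eq_matI) (auto simp: principal_submatrix_eq[OF A S] intro!: entry pick_less)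
  ultimately show ?thesis
    by (auto simp: psd_kernel_def principal_submatrix_eq[OF A S])
qed

lemma det_principal_submatrix_nonneg:
  assumes "psd_kernel n A" "S \<subseteq> {..<n}"
  shows "0 \<le> Determinant.det (principal_submatrix A S)"
  using psd_kernel_det_nonneg psd_kernel_principal_submatrix assms by blast

text \<open>Among the nonnegative minors that sum to this determinant, the empty one equals
  1.\<close>

lemma det_one_plus_psd_kernel_pos:
  assumes "psd_kernel n A"
  shows "0 < Determinant.det (one_mat n + A)"
proof -
  have A: "A \<in> carrier_mat n n" using assms by (simp add: psd_kernel_def)
  have "Determinant.det (principal_submatrix A {}) = 1"
    by (simp add: principal_submatrix_eq[OF A])
  then show ?thesis
    unfolding det_one_plus[OF A]
    by (intro sum_pos2[of _ "{}"]) (auto intro: det_principal_submatrix_nonneg[OF assms])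
qed

section \<open>The DPP and its success probability\<close>

lemma dpp_mass_nonneg:
  assumes "psd_kernel M L" "S \<subseteq> models M"
  shows "0 \<le> dpp_mass M L S"
  unfolding dpp_mass_def
  using det_principal_submatrix_nonneg[OF assms] det_one_plus_psd_kernel_pos[OF assms(1)]
  by simp

lemma sum_dpp_mass_Pow:
  assumes "psd_kernel M L" "F \<subseteq> models M"
  shows "(\<Sum>S\<in>Pow F. dpp_mass M L S) =
    Determinant.det (one_mat (card F) + principal_submatrix L F) / Determinant.det (one_mat M + L)"
proof -
  have "L \<in> carrier_mat M M" using assms(1) by (simp add: psd_kernel_def)
  from det_one_plus_principal_submatrix[OF this assms(2)] show ?thesis
    by (simp add: dpp_mass_def sum_divide_distrib)
qed

lemma sum_dpp_mass_models:
  assumes "psd_kernel M L"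
  shows "(\<Sum>S\<in>Pow (models M). dpp_mass M L S) = 1"
proof -
  have "L \<in> carrier_mat M M" using assms by (simp add: psd_kernel_def)
  then show ?thesis
    using sum_dpp_mass_Pow[OF assms order.refl] det_one_plus_psd_kernel_pos[OF assms]
    by (simp add: principal_submatrix_lessThan)
qed

text \<open>\<open>ennreal\<close> truncates negative reals to 0; nonnegativity of the masses
  ensures that nothing is lost in passing to the real sum.\<close>

lemma measure_dpp:
  assumes "psd_kernel M L" "X \<subseteq> Pow (models M)"
  shows "measure (dpp M L) X = (\<Sum>S\<in>X. dpp_mass M L S)"
proof -
  have nonneg: "0 \<le> dpp_mass M L S" if "S \<in> X" for S
    using assms that by (auto intro: dpp_mass_nonneg)
  have "emeasure (dpp M L) X = ennreal (\<Sum>S\<in>X. dpp_mass M L S)"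
    using assms nonneg
    by (simp add: dpp_def emeasure_point_measure_finite sum_ennreal)
  then show ?thesis
    by (simp add: measure_def sum_nonneg nonneg)
qed

lemma measure_dpp_subsets:
  assumes "psd_kernel M L" "F \<subseteq> models M"
  shows "measure (dpp M L) {S \<in> space (dpp M L). S \<subseteq> F} = (\<Sum>S\<in>Pow F. dpp_mass M L S)"
proof -
  have "{S \<in> space (dpp M L). S \<subseteq> F} = Pow F"
    using assms(2) by (auto simp: dpp_def space_point_measure)
  then show ?thesis
    using assms by (simp add: measure_dpp Pow_mono)
qed

lemma success_prob_eq_hit_mass:
  assumes "psd_kernel M L" "C \<subseteq> models M"
  shows "success_prob M L C = (\<Sum>S | S \<subseteq> models M \<and> S \<inter> C \<noteq> {}. dpp_mass M L S)"
proof -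
  let ?F = "models M - C"
  have "Pow (models M) - Pow ?F = {S. S \<subseteq> models M \<and> S \<inter> C \<noteq> {}}"
    using assms(2) by auto
  moreover have "(\<Sum>S\<in>Pow (models M) - Pow ?F. dpp_mass M L S) =
    1 - (\<Sum>S\<in>Pow ?F. dpp_mass M L S)"
    by (subst sum_diff) (auto simp: sum_dpp_mass_models[OF assms(1)])
  ultimately show ?thesis
    by (simp add: success_prob_def measure_dpp_subsets[OF assms(1)])
qed

lemma success_prob_nonneg:
  assumes "psd_kernel M L" "C \<subseteq> models M"
  shows "0 \<le> success_prob M L C"
  unfolding success_prob_eq_hit_mass[OF assms]
  by (intro sum_nonneg) (auto intro: dpp_mass_nonneg[OF assms(1)])

text \<open>The event depends on \<open>Y\<close> only through its law. Measurability into the count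
  space forces the values of \<open>Y\<close> to be subsets of the models, so the preimage is
  exactly the event on the left.\<close>

lemma measure_dpp_random_subset:
  assumes "dpp_random_subset \<Omega> Y M L"
  shows "measure \<Omega> {\<omega> \<in> space \<Omega>. Y \<omega> \<subseteq> F} = measure (dpp M L) {S \<in> space (dpp M L). S \<subseteq> F}"
proof -
  have Y: "Y \<in> measurable \<Omega> (count_space (Pow (models M)))"
    and distr: "dpp M L = distr \<Omega> (count_space (Pow (models M))) Y"
    using assms by (auto simp: dpp_random_subset_def)
  have "measure (dpp M L) {S \<in> space (dpp M L). S \<subseteq> F} =
    measure \<Omega> (Y -` {S \<in> Pow (models M). S \<subseteq> F} \<inter> space \<Omega>)"
    unfolding distr by (subst measure_distr[OF Y]) auto
  also have "Y -` {S \<in> Pow (models M). S \<subseteq> F} \<inter> space \<Omega> = {\<omega> \<in> space \<Omega>. Y \<omega> \<subseteq> F}"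
    using measurable_space[OF Y] by auto
  finally show ?thesis by simp
qed

text \<open>On nonnegative reals only 0 has value infinity, so strict order is reversed there too;
  negative arguments would all collapse to infinity.\<close>

lemma neg_log_less_iff:
  assumes "0 \<le> p" "0 \<le> q"
  shows "neg_log p < neg_log q \<longleftrightarrow> q < p"
  using assms by (auto simp: neg_log_def)


theorem proposition3:
  fixes M :: nat and C F :: "nat set" and L :: "real mat"
    and \<Omega> :: "'w measure" and Y :: "'w \<Rightarrow> nat set"
  assumes "psd_kernel M L"
    and "C \<subseteq> models M" and "F = models M - C"
    and "dpp_random_subset \<Omega> Y M L"
  shows "success_prob M L C = 1 - measure \<Omega> {\<omega> \<in> space \<Omega>. Y \<omega> \<subseteq> F} \<and>
         1 - measure \<Omega> {\<omega> \<in> space \<Omega>. Y \<omega> \<subseteq> F} =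
           (\<Sum>S | S \<subseteq> models M \<and> S \<inter> C \<noteq> {}. dpp_mass M L S) \<and>
         coverage_loss M L C =
           neg_log (1 - Determinant.det (one_mat (card F) + principal_submatrix L F) /
                        Determinant.det (one_mat M + L)) \<and>
         (\<forall>(\<Theta> :: 'p set) (K :: 'p \<Rightarrow> real mat) \<theta>.
           (\<forall>\<theta>' \<in> \<Theta>. psd_kernel M (K \<theta>')) \<longrightarrow>
           (is_arg_min (\<lambda>\<theta>'. coverage_loss M (K \<theta>') C) (\<lambda>\<theta>'. \<theta>' \<in> \<Theta>) \<theta> \<longleftrightarrow>
            is_arg_max (\<lambda>\<theta>'. \<Sum>S | S \<subseteq> models M \<and> S \<inter> C \<noteq> {}. dpp_mass M (K \<theta>') S)
              (\<lambda>\<theta>'. \<theta>' \<in> \<Theta>) \<theta>))"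
proof (intro conjI allI impI)
  have F: "F \<subseteq> models M" using assms(3) by auto
  show succ: "success_prob M L C = 1 - measure \<Omega> {\<omega> \<in> space \<Omega>. Y \<omega> \<subseteq> F}"
    unfolding success_prob_def measure_dpp_random_subset[OF assms(4)] assms(3) ..
  show "1 - measure \<Omega> {\<omega> \<in> space \<Omega>. Y \<omega> \<subseteq> F} =
    (\<Sum>S | S \<subseteq> models M \<and> S \<inter> C \<noteq> {}. dpp_mass M L S)"
    using succ success_prob_eq_hit_mass[OF assms(1,2)] by simp
  show "coverage_loss M L C =
    neg_log (1 - Determinant.det (one_mat (card F) + principal_submatrix L F) /
      Determinant.det (one_mat M + L))"
    using measure_dpp_subsets[OF assms(1) F] sum_dpp_mass_Pow[OF assms(1) F]
    by (simp add: coverage_loss_def success_prob_def assms(3))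
next
  fix \<Theta> :: "'p set" and K :: "'p \<Rightarrow> real mat" and \<theta>
  assume K: "\<forall>\<theta>' \<in> \<Theta>. psd_kernel M (K \<theta>')"
  \<comment> \<open>Being an optimiser means that no feasible parameter is strictly better, so
    reversing strict comparisons within \<open>\<Theta>\<close> suffices and no optimiser has to
    exist.\<close>
  have "coverage_loss M (K \<theta>') C < coverage_loss M (K \<theta>) C \<longleftrightarrow>
      (\<Sum>S | S \<subseteq> models M \<and> S \<inter> C \<noteq> {}. dpp_mass M (K \<theta>) S) <
      (\<Sum>S | S \<subseteq> models M \<and> S \<inter> C \<noteq> {}. dpp_mass M (K \<theta>') S)"
    if "\<theta> \<in> \<Theta>" "\<theta>' \<in> \<Theta>" for \<theta>'
    using that K assms(2) unfolding coverage_loss_def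
    by (simp add: neg_log_less_iff success_prob_nonneg success_prob_eq_hit_mass[symmetric])
  then show "is_arg_min (\<lambda>\<theta>'. coverage_loss M (K \<theta>') C) (\<lambda>\<theta>'. \<theta>' \<in> \<Theta>) \<theta> \<longleftrightarrow>
    is_arg_max (\<lambda>\<theta>'. \<Sum>S | S \<subseteq> models M \<and> S \<inter> C \<noteq> {}. dpp_mass M (K \<theta>') S)
      (\<lambda>\<theta>'. \<theta>' \<in> \<Theta>) \<theta>"
    unfolding is_arg_min_def is_arg_max_def by blast
qed

end
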